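(* There exists a strongly separately continuous function $f:(\mathbb R^{\aleph_0},\tau)\to\mathbb R$ which is not Baire measurable.
   Context: $\mathbb R^{\aleph_0}=\prod_{n=1}^\infty\mathbb R$ is the countable product of real lines and $\tau$ is the Tychonoff product topology on it. For $x=(x_n)_{n}$ and $a=(a_n)_n$ in $\mathbb R^{\aleph_0}$ and $k\in\mathbb N$, $x_k^a$ denotes the point whose $k$-th coordinate is $a_k$ and whose $n$-th coordinate is $x_n$ for all $n\ne k$. A function $f:(\mathbb R^{\aleph_0},\tau)\to\mathbb R$ is strongly separately continuous at $a$ with respect to the $k$-th variable if $\lim_{x\to a}|f(x)-f(x_k^a)|=0$, the limit being taken in the topology $\tau$; it is strongly separately continuous if this holds for every $a\in\mathbb R^{\aleph_0}$ and every $k\in\mathbb N$. Baire classes: for topological spaces $X,Y$, $B_0(X,Y)$ is the set of all continuous maps $X\to Y$; for $0<\alpha<\omega_1$, $B_\alpha(X,Y)$ is the set of all maps $f:X\to Y$ that are pointwise limits of a sequence of maps $f_n\in B_{\xi_n}(X,Y)$ with $\xi_n<\alpha$. A map $f:X\to Y$ is Baire measurable if $f\in\bigcup_{0\le\alpha<\omega_1}B_\alpha(X,Y)$. *)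

theory Defs
  imports "HOL-Analysis.Analysis" "HOL-Library.Countable_Set_Type"
begin

(* The sequence space is nat => real with the product topology of the library's instance of
   topological_space for functions (open_fun_def); coordinates are numbered from 0.
   The point x(k := a k) is x with its k-th coordinate replaced by that of a. *)

definition strongly_separately_continuous_at ::
    "((nat \<Rightarrow> real) \<Rightarrow> real) \<Rightarrow> (nat \<Rightarrow> real) \<Rightarrow> nat \<Rightarrow> bool" where
  "strongly_separately_continuous_at f a k \<longleftrightarrow>
     ((\<lambda>x. \<bar>f x - f (x(k := a k))\<bar>) \<longlongrightarrow> 0) (at a)"

definition strongly_separately_continuous :: "((nat \<Rightarrow> real) \<Rightarrow> real) \<Rightarrow> bool" where
  "strongly_separately_continuous f \<longleftrightarrow> (\<forall>a k. strongly_separately_continuous_at f a k)"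

(* The first uncountable ordinal, as a well-order: cardSuc natLeq is the successor cardinal of
   aleph_0, i.e. a well-order of least uncountable cardinality.  The elements of its field
   represent the ordinals alpha < omega_1, its least element representing 0. *)

definition omega1 :: "nat set rel" where
  "omega1 = cardSuc natLeq"

definition less_omega1 :: "nat set \<Rightarrow> nat set \<Rightarrow> bool" where
  "less_omega1 \<xi> \<alpha> \<longleftrightarrow> (\<xi>, \<alpha>) \<in> omega1 \<and> \<xi> \<noteq> \<alpha>"

definition is_zero_omega1 :: "nat set \<Rightarrow> bool" where
  "is_zero_omega1 \<alpha> \<longleftrightarrow> \<alpha> \<in> Field omega1 \<and> (\<forall>\<xi>. \<not> less_omega1 \<xi> \<alpha>)"

(* Transfinite recursion on alpha, presented inductively; the lemmas baire_class_zero and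
   baire_class_pos below are the defining equations. *)

inductive baire_class ::
    "nat set \<Rightarrow> ('a::topological_space \<Rightarrow> 'b::topological_space) \<Rightarrow> bool" where
  zero: "is_zero_omega1 \<alpha> \<Longrightarrow> continuous_on UNIV f \<Longrightarrow> baire_class \<alpha> f"
| limit: "\<alpha> \<in> Field omega1 \<Longrightarrow> \<not> is_zero_omega1 \<alpha> \<Longrightarrow>
    (\<And>n::nat. less_omega1 (\<xi> n) \<alpha>) \<Longrightarrow> (\<And>n. baire_class (\<xi> n) (F n)) \<Longrightarrow>
    (\<And>x. (\<lambda>n. F n x) \<longlonglongrightarrow> f x) \<Longrightarrow> baire_class \<alpha> f"

definition baire_measurable ::
    "('a::topological_space \<Rightarrow> 'b::topological_space) \<Rightarrow> bool" where
  "baire_measurable f \<longleftrightarrow> (\<exists>\<alpha>\<in>Field omega1. baire_class \<alpha> f)"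

lemma baire_class_zero:
  "is_zero_omega1 \<alpha> \<Longrightarrow> baire_class \<alpha> f \<longleftrightarrow> continuous_on UNIV f"
  by (auto elim: baire_class.cases intro: baire_class.zero)

lemma baire_class_pos:
  assumes "\<alpha> \<in> Field omega1" "\<not> is_zero_omega1 \<alpha>"
  shows "baire_class \<alpha> f \<longleftrightarrow>
    (\<exists>F \<xi>. (\<forall>n::nat. less_omega1 (\<xi> n) \<alpha> \<and> baire_class (\<xi> n) (F n)) \<and>
           (\<forall>x. (\<lambda>n. F n x) \<longlonglongrightarrow> f x))"
proof
  assume "baire_class \<alpha> f"
  then show "\<exists>F \<xi>. (\<forall>n::nat. less_omega1 (\<xi> n) \<alpha> \<and> baire_class (\<xi> n) (F n)) \<and>
           (\<forall>x. (\<lambda>n. F n x) \<longlonglongrightarrow> f x)"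
  proof cases
    case zero
    with assms(2) show ?thesis by simp
  next
    case (limit \<xi> F)
    then show ?thesis by (intro exI[of _ F] exI[of _ \<xi>]) simp
  qed
next
  assume "\<exists>F \<xi>. (\<forall>n::nat. less_omega1 (\<xi> n) \<alpha> \<and> baire_class (\<xi> n) (F n)) \<and>
           (\<forall>x. (\<lambda>n. F n x) \<longlonglongrightarrow> f x)"
  then obtain F \<xi> where "\<And>n. less_omega1 (\<xi> n) \<alpha>" "\<And>n. baire_class (\<xi> n) (F n)"
    "\<And>x. (\<lambda>n. F n x) \<longlonglongrightarrow> f x" by auto
  then show "baire_class \<alpha> f"
    by (rule baire_class.limit[OF assms])
qed

lemma Well_order_omega1: "Well_order omega1"
  unfolding omega1_def using cardSuc_Card_order[OF natLeq_Card_order]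
  by (simp add: card_order_on_def)

lemma uncountable_Field_omega1: "uncountable (Field omega1)"
proof
  assume "countable (Field omega1)"
  then have "(card_of (Field omega1), natLeq) \<in> ordLeq"
    by (simp only: countable_card_le_natLeq)
  moreover have "(natLeq, card_of (Field omega1)) \<in> ordLess"
    unfolding omega1_def
    by (rule ordLess_ordIso_trans[OF cardSuc_greater[OF natLeq_Card_order]
          ordIso_symmetric[OF card_of_Field_ordIso[OF cardSuc_Card_order[OF natLeq_Card_order]]]])
  ultimately show False
    by (simp add: not_ordLess_ordLeq)
qed

lemma countable_less_omega1: "countable {\<xi>. less_omega1 \<xi> \<alpha>}"
proof (cases "\<alpha> \<in> Field omega1")
  case True
  have "(card_of (underS omega1 \<alpha>), omega1) \<in> ordLess"
    by (rule card_of_underS[OF _ True])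
      (simp add: omega1_def cardSuc_Card_order[OF natLeq_Card_order])
  then have "(card_of (underS omega1 \<alpha>), natLeq) \<in> ordLeq"
    unfolding omega1_def
    by (rule cardSuc_ordLeq_ordLess[OF natLeq_Card_order card_of_Card_order, THEN iffD1])
  then have "countable (underS omega1 \<alpha>)"
    by (simp only: countable_card_le_natLeq)
  moreover have "{\<xi>. less_omega1 \<xi> \<alpha>} = underS omega1 \<alpha>"
    by (auto simp: less_omega1_def underS_def)
  ultimately show ?thesis by simp
next
  case False
  then have "{\<xi>. less_omega1 \<xi> \<alpha>} = {}"
    by (auto simp: less_omega1_def Field_def)
  then show ?thesis by simp
qed

end

(* Compose a non-measurable function on the reals with the limit functional on sequences. The limit
   ignores finitely many coordinates, so the composite is strongly separately continuous for trivial
   reasons; restricted to constant sequences it is the original function, so it is not Borel, whereas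
   every Baire measurable function is. *)

theory Submission
  imports Defs
begin

text \<open>Vitali's construction: choose one point of \<open>{0..1}\<close> from each coset of the
  rationals. The rational translates of the chosen set are pairwise disjoint and cover the line,
  which no Lebesgue measure of the set permits.\<close>

lemma exists_non_lebesgue_set: "\<exists>V :: real set. V \<notin> sets lebesgue"
proof -
  define rep where "rep x = (SOME y. y \<in> {0..1} \<and> x - y \<in> \<rat>)" for x :: real
  have rep: "rep x \<in> {0..1} \<and> x - rep x \<in> \<rat>" for x
    unfolding rep_def
  proof (rule someI)
    show "frac x \<in> {0..1} \<and> x - frac x \<in> \<rat>"
      by (auto simp: frac_def intro: less_imp_le) linarith+
  qed
  have rep_eq: "rep x = rep y" if "x - y \<in> \<rat>" for x y
  proof -
    \<comment> \<open>Points of one coset satisfy the same condition under \<open>SOME\<close>, so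
      the choice returns the same point for both.\<close>
    have "x - z \<in> \<rat> \<longleftrightarrow> y - z \<in> \<rat>" for z
      using Rats_diff[OF _ that, of "x - z"] Rats_add[OF _ that, of "y - z"] by auto
    then show ?thesis by (simp add: rep_def)
  qed
  define V where "V = range rep"
  have V_sub: "V \<subseteq> {0..1}"
    using rep by (auto simp: V_def)
  have cover: "(\<Union>q\<in>\<rat>. (+) q ` V) = UNIV"
  proof -
    have "x \<in> (\<Union>q\<in>\<rat>. (+) q ` V)" for x
      using rep[of x] by (intro UN_I[of "x - rep x"] image_eqI[of _ _ "rep x"]) (auto simp: V_def)
    then show ?thesis by blast
  qed
  have disj: "(+) p ` V \<inter> (+) q ` V = {}" if "p \<in> \<rat>" "q \<in> \<rat>" "p \<noteq> q" for p q
  proof -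
    have False if "p + rep x = q + rep y" for x y
    proof -
      have "rep x - rep y = q - p"
        using that by linarith
      then have "rep x - rep y \<in> \<rat>"
        using \<open>p \<in> \<rat>\<close> \<open>q \<in> \<rat>\<close> by simp
      \<comment> \<open>\<open>x - y\<close> is
        \<open>(x - rep x) + (rep x - rep y) - (y - rep y)\<close>, a combination of
        rationals.\<close>
      then have "x - y \<in> \<rat>"
        using Rats_diff[OF Rats_add[of "x - rep x" "rep x - rep y"], of "y - rep y"]
          rep[of x] rep[of y] by simp
      then show False
        using rep_eq[of x y] that \<open>p \<noteq> q\<close> by simp
    qed
    then show ?thesis by (auto simp: V_def)
  qed
  have "V \<notin> sets lebesgue"
  proof
    assume "V \<in> sets lebesgue"
    then have V: "V \<in> lmeasurable"
      using V_sub bounded_subset[OF bounded_closed_interval]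
      by (intro bounded_set_imp_lmeasurable) auto
    \<comment> \<open>Any \<open>n\<close> rationals of \<open>{0..1}\<close> give \<open>n\<close>
      disjoint translates of equal measure, all inside \<open>{0..2}\<close>. As \<open>n\<close> is
      arbitrary, \<open>V\<close> must be null.\<close>
    have bound: "real n * measure lebesgue V \<le> 2" for n
    proof -
      have "infinite (\<rat> \<inter> {0..1} :: real set)"
      proof -
        have "(\<lambda>k::nat. 1 / real (Suc k)) ` UNIV \<subseteq> \<rat> \<inter> {0..1}"
          by auto
        moreover have "infinite ((\<lambda>k::nat. 1 / real (Suc k)) ` UNIV)"
          by (rule range_inj_infinite) (auto simp: inj_on_def)
        ultimately show ?thesis by (rule infinite_super)
      qed
      then obtain Q where Q: "Q \<subseteq> \<rat> \<inter> {0..1::real}" "finite Q" "card Q = n"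
        by (meson infinite_arbitrarily_large)
      have "real n * measure lebesgue V = (\<Sum>q\<in>Q. measure lebesgue ((+) q ` V))"
        using Q by (simp add: measure_translation)
      also have "\<dots> = measure lebesgue (\<Union>q\<in>Q. (+) q ` V)"
        using Q V disj
        by (intro measure_UNION'[symmetric])
          (auto simp: measurable_translation pairwise_def disjnt_def subset_iff)
      also have "\<dots> \<le> measure lebesgue {0..2::real}"
      proof (rule measure_mono_fmeasurable)
        show "(\<Union>q\<in>Q. (+) q ` V) \<subseteq> {0..2}"
        proof (rule UN_least)
          fix q assume "q \<in> Q"
          then have "q \<in> {0..1}" using Q by blast
          then show "(+) q ` V \<subseteq> {0..2}" using V_sub by (fastforce simp: subset_iff)
        qed
        show "(\<Union>q\<in>Q. (+) q ` V) \<in> sets lebesgue"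
          using Q V by (intro sets.finite_UN fmeasurableD measurable_translation) auto
      qed auto
      finally show ?thesis by simp
    qed
    have "measure lebesgue V = 0"
    proof (rule ccontr)
      assume "measure lebesgue V \<noteq> 0"
      then have "measure lebesgue V > 0" using measure_nonneg[of lebesgue V] by linarith
      then obtain n where "real n * measure lebesgue V > 2"
        using reals_Archimedean3 by blast
      with bound[of n] show False by simp
    qed
    then have "(+) q ` V \<in> null_sets lebesgue" for q
      using measurable_translation[OF V, of q]
      by (intro null_setsI) (auto simp: emeasure_eq_measure2 measure_translation)
    \<comment> \<open>Countably many null translates would make the whole line null.\<close>
    then have "(\<Union>q\<in>\<rat>. (+) q ` V) \<in> null_sets lebesgue"
      by (intro null_sets_UN' countable_rat)
    then show False
      using cover fmeasurableI_null_sets not_measurable_UNIV by metis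
  qed
  then show ?thesis by blast
qed

text \<open>Continuous maps are Borel, and pointwise limits of sequences of Borel maps into a metric
  space stay Borel, so rule induction climbs through all classes.\<close>

lemma baire_class_imp_borel_measurable:
  fixes f :: "'a::topological_space \<Rightarrow> 'b::metric_space"
  assumes "baire_class \<alpha> f"
  shows "f \<in> borel_measurable borel"
  using assms
proof induction
  case (zero \<alpha> f)
  then show ?case by (simp add: borel_measurable_continuous_onI)
next
  case (limit \<alpha> \<xi> F f)
  show ?case
    by (rule borel_measurable_LIMSEQ_metric[where f = F]) (use limit in auto)
qed

text \<open>Both sequences have the same limits, so the definite description behind
  \<open>lim\<close> agrees on them, even at divergent sequences, where its value is
  unspecified.\<close>

lemma lim_fun_upd:
  fixes x :: "nat \<Rightarrow> 'a::t2_space"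
  shows "lim (x(k := c)) = lim x"
proof -
  have "eventually (\<lambda>n. (x(k := c)) n = x n) sequentially"
    using eventually_gt_at_top[of k] by eventually_elim simp
  then have "x(k := c) \<longlonglongrightarrow> L \<longleftrightarrow> x \<longlonglongrightarrow> L" for L
    by (rule tendsto_cong)
  then show ?thesis by (simp add: lim_def)
qed

theorem proposition3p2:
  shows "\<exists>f :: (nat \<Rightarrow> real) \<Rightarrow> real.
    strongly_separately_continuous f \<and> \<not> baire_measurable f"
proof -
  obtain V :: "real set" where V: "V \<notin> sets lebesgue"
    using exists_non_lebesgue_set by blast
  define f :: "(nat \<Rightarrow> real) \<Rightarrow> real" where "f x = indicator V (lim x)" for x
  have "strongly_separately_continuous f"
    by (simp add: strongly_separately_continuous_def strongly_separately_continuous_at_def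
        f_def lim_fun_upd)
  moreover have "\<not> baire_measurable f"
  proof
    assume "baire_measurable f"
    then have "f \<in> borel_measurable borel"
      unfolding baire_measurable_def by (blast intro: baire_class_imp_borel_measurable)
    \<comment> \<open>The diagonal embedding is continuous because each of its coordinates is the
      identity.\<close>
    moreover have "(\<lambda>t n. t) \<in> borel_measurable (borel :: real measure)"
      by (intro borel_measurable_continuous_onI continuous_on_coordinatewise_then_product
          continuous_on_id)
    ultimately have "(\<lambda>t. f (\<lambda>n. t)) \<in> borel_measurable borel"
      by (rule measurable_compose[rotated])
    then have "indicat_real V \<in> borel_measurable borel"
      by (simp add: f_def limI[OF tendsto_const])
    then have "V \<in> sets borel"
      by (simp add: borel_measurable_indicator_iff)
    \<comment> \<open>Lebesgue measure completes \<open>lborel\<close>, so every Borel set is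
      Lebesgue measurable.\<close>
    with V show False
      by (metis sets_completionI_sets sets_lborel)
  qed
  ultimately show ?thesis by blast
qed

end
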